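(* Let $\mathcal{H}$ be a Hilbert space, let $I$ be $\mathbb{N}$ or $\mathbb{Z}$, and suppose $\{f_n\}_{n\in I}\subseteq\mathcal{H}$ is an unconditional Schauder basis. Then $\{f_n\}_{n\in I}$ does frame reconstruction if and only if $$\inf_n\|f_n\|>0.$$
   Context: $B(\mathcal{H})$ is the space of bounded linear operators on $\mathcal{H}$; inner products are linear in the first variable; $\mathbb{N}=\{0,1,2,\dots\}$. A sequence $\{f_n\}_{n\in I}\subseteq\mathcal{H}$ ($I=\mathbb{N}$ or $\mathbb{Z}$) does frame reconstruction if there is $B\in B(\mathcal{H})$ such that for every $f\in\mathcal{H}$ one has $\sum_{n=0}^{\infty}\langle f,Bf_n\rangle f_n=f$ when $I=\mathbb{N}$, respectively $\lim_{M\to\infty}\sum_{n=-M}^{M}\langle f,Bf_n\rangle f_n=f$ when $I=\mathbb{Z}$, with convergence in norm. $\{f_n\}_{n\in I}$ is an unconditional Schauder basis of $\mathcal{H}$ if there is $\{g_n\}_{n\in I}\subseteq\mathcal{H}$ with $\langle f_n,g_k\rangle=\delta_{nk}$ and $f=\sum_n\langle f,g_n\rangle f_n$ with unconditional norm convergence for all $f\in\mathcal{H}$. *)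

theory Defs
  imports "HOL-Analysis.Analysis"
begin

text \<open>
  Complex Hilbert spaces. As usual in mathematics, and unlike in many formal developments, the
  inner product is linear in its first argument. The norm is the one of the underlying real normed
  space, tied to the inner product by the last axiom, which also gives positive definiteness.
\<close>

class complex_inner = real_normed_vector +
  fixes scaleC :: "complex \<Rightarrow> 'a \<Rightarrow> 'a" (infixr \<open>*\<^sub>C\<close> 75)
    and cinner :: "'a \<Rightarrow> 'a \<Rightarrow> complex"
  assumes scaleC_add_right: "c *\<^sub>C (x + y) = c *\<^sub>C x + c *\<^sub>C y"
    and scaleC_add_left: "(c + d) *\<^sub>C x = c *\<^sub>C x + d *\<^sub>C x"
    and scaleC_scaleC: "c *\<^sub>C (d *\<^sub>C x) = (c * d) *\<^sub>C x"
    and scaleC_of_real: "complex_of_real r *\<^sub>C x = r *\<^sub>R x"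
    and cinner_commute: "cinner x y = cnj (cinner y x)"
    and cinner_add_left: "cinner (x + y) z = cinner x z + cinner y z"
    and cinner_scaleC_left: "cinner (c *\<^sub>C x) y = c * cinner x y"
    and cinner_self: "cinner x x = complex_of_real ((norm x)\<^sup>2)"

class complex_hilbert_space = complex_inner + complete_space

definition bounded_clinear :: "('a::complex_inner \<Rightarrow> 'b::complex_inner) \<Rightarrow> bool" where
  "bounded_clinear B \<longleftrightarrow> bounded_linear B \<and> (\<forall>c x. B (c *\<^sub>C x) = c *\<^sub>C B x)"

definition frame_reconstruction_nat :: "(nat \<Rightarrow> 'a::complex_hilbert_space) \<Rightarrow> bool" where
  "frame_reconstruction_nat f \<longleftrightarrow>
     (\<exists>B. bounded_clinear B \<and> (\<forall>h. (\<lambda>n. cinner h (B (f n)) *\<^sub>C f n) sums h))"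

definition frame_reconstruction_int :: "(int \<Rightarrow> 'a::complex_hilbert_space) \<Rightarrow> bool" where
  "frame_reconstruction_int f \<longleftrightarrow>
     (\<exists>B. bounded_clinear B \<and>
        (\<forall>h. (\<lambda>M. \<Sum>n = - int M..int M. cinner h (B (f n)) *\<^sub>C f n) \<longlonglongrightarrow> h))"

text \<open>
  Unconditional convergence is expressed by \<^const>\<open>has_sum\<close>, i.e.\ convergence of the net of all
  finite partial sums; in a Banach space and for a countable index set this is the same as
  convergence to the same sum for every enumeration of the index set.
\<close>

definition unconditional_schauder_basis :: "('i \<Rightarrow> 'a::complex_hilbert_space) \<Rightarrow> bool" where
  "unconditional_schauder_basis f \<longleftrightarrow>
     (\<exists>g. (\<forall>n k. cinner (f n) (g k) = (if n = k then 1 else 0)) \<and>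
          (\<forall>h. ((\<lambda>n. cinner h (g n) *\<^sub>C f n) has_sum h) UNIV))"

end

theory Submission
  imports Defs
begin

text \<open>
  Let \<open>g\<close> be biorthogonal to \<open>f\<close>. Uniqueness of expansions shows that a reconstructing \<open>B\<close> must satisfy
  \<open>B f\<^sub>n = g\<^sub>n\<close>, so \<open>1 = \<langle>f\<^sub>n, B f\<^sub>n\<rangle> \<le> \<parallel>B\<parallel> \<parallel>f\<^sub>n\<parallel>\<^sup>2\<close>. Conversely, by the uniform boundedness
  principle the partial expansions over finite sets are uniformly bounded operators, hence so are
  all signed finite expansions. A suitable choice of signs gives
  \<open>\<Sum> \<bar>\<langle>h, g\<^sub>n\<rangle>\<bar>\<^sup>2 \<parallel>f\<^sub>n\<parallel>\<^sup>2 \<le> (2 K \<parallel>h\<parallel>)\<^sup>2\<close>. If \<open>\<parallel>f\<^sub>n\<parallel>\<close> is bounded below, then \<open>g\<close> is a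
  Bessel sequence, and its frame operator \<open>B h = \<Sum> \<langle>h, g\<^sub>n\<rangle> g\<^sub>n\<close> maps \<open>f\<^sub>n\<close> to \<open>g\<^sub>n\<close>.
\<close>

subsection \<open>Complex inner products\<close>

instance complex_hilbert_space \<subseteq> banach ..

lemma cinner_add_right: "cinner x (y + z) = cinner x y + cinner x z"
  by (metis cinner_add_left cinner_commute complex_cnj_add)

lemma cinner_scaleC_right: "cinner x (c *\<^sub>C y) = cnj c * cinner x y"
  by (metis cinner_commute cinner_scaleC_left complex_cnj_mult)

text \<open>The class assumes a normed space over the reals only; homogeneity for complex scalars is
  recovered from \<open>cinner_self\<close>.\<close>

lemma norm_scaleC: "norm (c *\<^sub>C x) = cmod c * norm (x :: 'a::complex_inner)"
proof -
  have "complex_of_real ((norm (c *\<^sub>C x))\<^sup>2) = (c * cnj c) * complex_of_real ((norm x)\<^sup>2)"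
    by (simp only: cinner_self[symmetric] cinner_scaleC_left cinner_scaleC_right mult_ac)
  also have "\<dots> = complex_of_real ((cmod c * norm x)\<^sup>2)"
    by (simp add: complex_norm_square[symmetric] power_mult_distrib)
  finally have "(norm (c *\<^sub>C x))\<^sup>2 = (cmod c * norm x)\<^sup>2"
    using of_real_eq_iff by blast
  then show ?thesis
    by simp
qed

lemma norm_add_square:
  "(norm (x + y :: 'a::complex_inner))\<^sup>2 = (norm x)\<^sup>2 + 2 * Re (cinner x y) + (norm y)\<^sup>2"
proof -
  have "(norm (x + y))\<^sup>2 = Re (cinner (x + y) (x + y))"
    by (simp only: cinner_self Re_complex_of_real)
  also have "\<dots> = Re (cinner x x) + Re (cinner x y) + Re (cinner y x) + Re (cinner y y)"
    by (simp add: cinner_add_left cinner_add_right)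
  also have "Re (cinner y x) = Re (cinner x y)"
    by (subst cinner_commute) simp
  finally show ?thesis
    by (simp add: cinner_self)
qed

text \<open>Cauchy-Schwarz. The triangle inequality is already available from the normed space, so
  comparing it with the expansion of the squared norm of a sum bounds the real part; a rotation then
  reaches the modulus.\<close>

lemma cmod_cinner_le: "cmod (cinner x y) \<le> norm x * norm (y :: 'a::complex_inner)"
proof -
  have real_part: "Re (cinner u y) \<le> norm u * norm y" for u
  proof -
    have "(norm (u + y))\<^sup>2 \<le> (norm u + norm y)\<^sup>2"
      by (intro power_mono norm_triangle_ineq) simp
    then show ?thesis
      by (simp add: norm_add_square power2_sum)
  qed
  show ?thesis
  proof (cases "cinner x y = 0")
    case False
    \<comment> \<open>A unimodular factor that turns the inner product into its own modulus.\<close>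
    define c where "c = cnj (sgn (cinner x y))"
    have c: "cmod c = 1"
      using False by (simp add: c_def norm_sgn)
    have "cinner (c *\<^sub>C x) y = complex_of_real (cmod (cinner x y))"
      using False complex_norm_square[of "cinner x y"]
      by (simp add: cinner_scaleC_left c_def sgn_eq field_simps power2_eq_square)
    then show ?thesis
      using real_part[of "c *\<^sub>C x"] c by (simp add: norm_scaleC)
  qed auto
qed

lemma bounded_linear_cinner_left: "bounded_linear (\<lambda>x :: 'a::complex_inner. cinner x y)"
proof (rule bounded_linear_intro[where K = "norm y"])
  show "cinner (r *\<^sub>R x) y = r *\<^sub>R cinner x y" for r x
    by (metis cinner_scaleC_left scaleC_of_real scaleR_conv_of_real)
qed (simp_all add: cinner_add_left cmod_cinner_le)

lemma bounded_linear_scaleC_left: "bounded_linear (\<lambda>c. c *\<^sub>C (x :: 'a::complex_inner))"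
proof (rule bounded_linear_intro[where K = "norm x"])
  show "(r *\<^sub>R c) *\<^sub>C x = r *\<^sub>R (c *\<^sub>C x)" for r c
    by (metis scaleC_of_real scaleC_scaleC scaleR_conv_of_real)
qed (simp_all add: scaleC_add_left norm_scaleC)

lemma bounded_linear_scaleC_right: "bounded_linear (\<lambda>x :: 'a::complex_inner. c *\<^sub>C x)"
proof (rule bounded_linear_intro[where K = "cmod c"])
  show "c *\<^sub>C (r *\<^sub>R x) = r *\<^sub>R (c *\<^sub>C x)" for r and x :: 'a
    by (metis scaleC_of_real scaleC_scaleC mult.commute)
qed (simp_all add: scaleC_add_right norm_scaleC)

lemma scaleC_zero_left: "0 *\<^sub>C x = (0 :: 'a::complex_inner)"
  by (rule linear_0[OF bounded_linear.linear[OF bounded_linear_scaleC_left]])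

lemma scaleC_one: "1 *\<^sub>C x = (x :: 'a::complex_inner)"
  using scaleC_of_real[of 1 x] by simp

lemma cinner_sum_left: "cinner (\<Sum>i\<in>F. v i) y = (\<Sum>i\<in>F. cinner (v i) (y :: 'a::complex_inner))"
  by (rule linear_sum[OF bounded_linear.linear[OF bounded_linear_cinner_left]])

text \<open>\<open>A\<close> carries the plus signs and \<open>F - A\<close> the minus signs. The
  average of the squared norm over all signs is the left-hand side; instead of averaging, one good
  choice is built greedily by induction.\<close>

lemma exists_signs_sum_norm_square_le:
  fixes v :: "'i \<Rightarrow> 'a::complex_inner"
  assumes "finite F"
  shows "\<exists>A\<subseteq>F. (\<Sum>i\<in>F. (norm (v i))\<^sup>2) \<le> (norm (sum v A - sum v (F - A)))\<^sup>2"
  using assms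
proof (induction F)
  case (insert a F)
  then obtain A where A: "A \<subseteq> F" "(\<Sum>i\<in>F. (norm (v i))\<^sup>2) \<le> (norm (sum v A - sum v (F - A)))\<^sup>2"
    by blast
  let ?w = "sum v A - sum v (F - A)"
  have fin: "finite A" "a \<notin> A"
    using A insert finite_subset by auto
  have sums: "(\<Sum>i\<in>insert a F. (norm (v i))\<^sup>2) \<le> (norm ?w)\<^sup>2 + (norm (v a))\<^sup>2"
    using insert A by simp
  \<comment> \<open>the sign of the new vector is chosen so that the cross term is nonnegative\<close>
  show ?case
  proof (cases "Re (cinner ?w (v a)) \<ge> 0")
    case True
    have "sum v (insert a A) - sum v (insert a F - insert a A) = ?w + v a"
      using fin insert by (simp add: insert_Diff_if)
    then have "(\<Sum>i\<in>insert a F. (norm (v i))\<^sup>2)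
        \<le> (norm (sum v (insert a A) - sum v (insert a F - insert a A)))\<^sup>2"
      using sums True by (simp add: norm_add_square)
    then show ?thesis
      using A by blast
  next
    case False
    have "sum v A - sum v (insert a F - A) = ?w + - v a"
      using fin insert by (simp add: insert_Diff_if)
    moreover have "Re (cinner ?w (- v a)) = - Re (cinner ?w (v a))"
      using cinner_scaleC_right[of ?w "-1" "v a"] scaleC_of_real[of "-1" "v a"] by simp
    ultimately have "(\<Sum>i\<in>insert a F. (norm (v i))\<^sup>2) \<le> (norm (sum v A - sum v (insert a F - A)))\<^sup>2"
      using sums False norm_add_square[of ?w "- v a"] by (simp only: norm_minus_cancel)
    then show ?thesis
      using A by blast
  qed
qed auto

subsection \<open>Uniform boundedness and unconditional summation\<close>

text \<open>Uniform boundedness by Baire: pointwise bounds cover the space by the closed sets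
  \<open>E k\<close>, so some \<open>E k\<close> contains a ball.\<close>

theorem banach_steinhaus:
  fixes T :: "'i \<Rightarrow> 'a::banach \<Rightarrow> 'b::real_normed_vector"
  assumes lin: "\<And>i. bounded_linear (T i)"
    and bdd: "\<And>x. \<exists>M. \<forall>i. norm (T i x) \<le> M"
  obtains K where "K \<ge> 0" "\<And>i x. norm (T i x) \<le> K * norm x"
proof -
  define E where "E k = {x. \<forall>i. norm (T i x) \<le> real k}" for k :: nat
  have closed: "closed (E k)" for k
  proof -
    have "E k = (\<Inter>i. {x. norm (T i x) \<le> real k})"
      by (auto simp: E_def)
    moreover have "closed {x. norm (T i x) \<le> real k}" for i
      by (intro closed_Collect_le continuous_intros bounded_linear.continuous_on[OF lin])
    ultimately show ?thesis
      by auto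
  qed
  have cover: "(\<Union>k. E k) = UNIV"
  proof safe
    fix x
    obtain M where "\<forall>i. norm (T i x) \<le> M"
      using bdd by blast
    moreover obtain k where "M \<le> real k"
      using real_arch_simple by blast
    ultimately have "x \<in> E k"
      unfolding E_def by (blast intro: order_trans)
    then show "x \<in> (\<Union>k. E k)"
      by blast
  qed auto
  have "\<exists>k. interior (E k) \<noteq> {}"
  proof (rule ccontr)
    assume "\<not> ?thesis"
    then have "euclidean interior_of (\<Union>(range E)) = {}"
      using Baire_category_alt[OF disjI1[OF completely_metrizable_space_euclidean], of "range E"] closed
      by fastforce
    then show False
      using cover by simp
  qed
  then obtain k x r where r: "r > 0" "ball x r \<subseteq> E k"
    by (meson all_not_in_conv mem_interior)
  \<comment> \<open>With \<open>s\<close> as below, \<open>x\<close> and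
    \<open>x + s *\<^sub>R y\<close> both lie in the ball. The difference of their images has norm
    at most \<open>2 * k\<close>, and dividing by \<open>s\<close> yields the factor
    \<open>4 * k / r\<close>.\<close>
  have "norm (T i y) \<le> (4 * real k / r) * norm y" for i y
  proof (cases "y = 0")
    case True
    then show ?thesis
      using linear_0[OF bounded_linear.linear[OF lin]] by simp
  next
    case False
    define s where "s = r / (2 * norm y)"
    have s: "s > 0"
      using False r by (simp add: s_def)
    have "x + s *\<^sub>R y \<in> ball x r" "x \<in> ball x r"
      using r False by (simp_all add: dist_norm s_def)
    then have "x + s *\<^sub>R y \<in> E k" "x \<in> E k"
      using r by blast+
    then have "norm (T i (x + s *\<^sub>R y)) \<le> real k" "norm (T i x) \<le> real k"
      by (simp_all add: E_def)
    moreover have "T i (x + s *\<^sub>R y) = T i x + s *\<^sub>R T i y"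
      using lin[of i] by (simp add: linear_simps)
    ultimately have "norm (s *\<^sub>R T i y) \<le> 2 * real k"
      using norm_triangle_ineq4[of "T i x + s *\<^sub>R T i y" "T i x"] by simp
    then have "s * norm (T i y) \<le> 2 * real k"
      using s by simp
    then show ?thesis
      using r False by (simp add: s_def field_simps)
  qed
  moreover have "4 * real k / r \<ge> 0"
    using r by simp
  ultimately show ?thesis
    using that by blast
qed

text \<open>The Cauchy criterion for the net of finite partial sums, combined with
  completeness.\<close>

lemma summable_on_of_small_tails:
  fixes v :: "'i \<Rightarrow> 'a::banach"
  assumes tails: "\<And>e. e > 0 \<Longrightarrow> \<exists>F. finite F \<and> (\<forall>G. finite G \<and> G \<inter> F = {} \<longrightarrow> norm (sum v G) < e)"
  shows "v summable_on UNIV"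
proof -
  have "\<exists>P. eventually P (finite_subsets_at_top UNIV) \<and>
      (\<forall>A B. P A \<and> P B \<longrightarrow> dist (sum v A) (sum v B) < e)" if "e > 0" for e
  proof -
    obtain F where F: "finite F" "\<And>G. finite G \<Longrightarrow> G \<inter> F = {} \<Longrightarrow> norm (sum v G) < e / 2"
      using tails[of "e / 2"] \<open>e > 0\<close> by auto
    have near: "dist (sum v A) (sum v F) < e / 2" if "finite A" "F \<subseteq> A" for A
      using F(2)[of "A - F"] that sum_diff[of A F v] by (auto simp: dist_norm)
    have "dist (sum v A) (sum v B) < e" if "finite A \<and> F \<subseteq> A" "finite B \<and> F \<subseteq> B" for A B
      using near[of A] near[of B] that dist_triangle_half_l by blast
    moreover have "eventually (\<lambda>A. finite A \<and> F \<subseteq> A) (finite_subsets_at_top UNIV)"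
      using F(1) by (auto simp: eventually_finite_subsets_at_top)
    ultimately show ?thesis
      by blast
  qed
  then have "cauchy_filter (filtermap (sum v) (finite_subsets_at_top UNIV))"
    by (auto simp: cauchy_filter_metric_filtermap)
  then obtain s where "filtermap (sum v) (finite_subsets_at_top UNIV) \<le> nhds s"
    using cauchy_filter_complete_converges[OF _ complete_UNIV,
        of "filtermap (sum v) (finite_subsets_at_top UNIV)"]
    by (auto simp: filtermap_bot_iff)
  then show ?thesis
    by (auto simp: summable_on_def has_sum_def filterlim_def)
qed

text \<open>Enlarging \<open>F\<close> by a fixed finite \<open>X\<close> brings its sum within 1 of
  \<open>s\<close>; the surplus over \<open>X - F\<close> is bounded independently of
  \<open>F\<close>.\<close>

lemma has_sum_finite_sums_bounded:
  fixes v :: "'i \<Rightarrow> 'a::real_normed_vector"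
  assumes "(v has_sum s) UNIV"
  obtains M where "\<And>F. finite F \<Longrightarrow> norm (sum v F) \<le> M"
proof -
  have "\<forall>\<^sub>F A in finite_subsets_at_top UNIV. dist (sum v A) s < 1"
    using assms by (auto simp: has_sum_def tendsto_iff)
  then obtain X where X: "finite X" "\<And>A. finite A \<Longrightarrow> X \<subseteq> A \<Longrightarrow> dist (sum v A) s < 1"
    by (auto simp: eventually_finite_subsets_at_top)
  have "norm (sum v F) \<le> (norm s + 1) + (\<Sum>i\<in>X. norm (v i))" if "finite F" for F
  proof -
    have "sum v F = sum v (F \<union> X) - sum v (X - F)"
      using that X(1) sum.union_disjoint[of F "X - F" v] by auto
    moreover have "norm (sum v (F \<union> X)) \<le> norm s + 1"
      using X(2)[of "F \<union> X"] that X(1) norm_triangle_sub[of "sum v (F \<union> X)" s]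
      by (simp add: dist_norm)
    moreover have "norm (sum v (X - F)) \<le> (\<Sum>i\<in>X. norm (v i))"
      using X(1) by (intro order_trans[OF norm_sum] sum_mono2) auto
    ultimately show ?thesis
      using norm_triangle_ineq4[of "sum v (F \<union> X)" "sum v (X - F)"] by simp
  qed
  then show ?thesis
    using that by blast
qed

subsection \<open>Frame operators of Bessel sequences\<close>

text \<open>Synthesis is adjoint to analysis and inherits its bound: pair the vector with itself,
  apply Cauchy-Schwarz to the coefficients, and cancel a squared norm.\<close>

lemma norm_synthesis_le:
  fixes g :: "'i \<Rightarrow> 'a::complex_inner"
  assumes "C \<ge> 0" and bessel: "\<And>h. (\<Sum>i\<in>F. (cmod (cinner h (g i)))\<^sup>2) \<le> C * (norm h)\<^sup>2"
  shows "(norm (\<Sum>i\<in>F. c i *\<^sub>C g i))\<^sup>2 \<le> C * (\<Sum>i\<in>F. (cmod (c i))\<^sup>2)"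
proof -
  define v where "v = (\<Sum>i\<in>F. c i *\<^sub>C g i)"
  have "(norm v)\<^sup>2 = cmod (cinner v v)"
    by (simp add: cinner_self norm_power)
  also have "cinner v v = (\<Sum>i\<in>F. c i * cinner (g i) v)"
    by (subst (1) v_def) (simp add: cinner_sum_left cinner_scaleC_left)
  also have "cmod \<dots> \<le> (\<Sum>i\<in>F. cmod (c i) * cmod (cinner v (g i)))"
    by (rule order_trans[OF norm_sum])
      (metis (no_types, lifting) cinner_commute complex_mod_cnj norm_mult order_refl sum.cong)
  finally have "((norm v)\<^sup>2)\<^sup>2 \<le> (\<Sum>i\<in>F. cmod (c i) * cmod (cinner v (g i)))\<^sup>2"
    by (intro power_mono) auto
  also have "\<dots> \<le> (\<Sum>i\<in>F. (cmod (c i))\<^sup>2) * (\<Sum>i\<in>F. (cmod (cinner v (g i)))\<^sup>2)"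
    by (rule Cauchy_Schwarz_ineq_sum)
  also have "\<dots> \<le> (\<Sum>i\<in>F. (cmod (c i))\<^sup>2) * (C * (norm v)\<^sup>2)"
    by (intro mult_left_mono bessel sum_nonneg) simp
  finally have *: "(norm v)\<^sup>2 * (norm v)\<^sup>2 \<le> (C * (\<Sum>i\<in>F. (cmod (c i))\<^sup>2)) * (norm v)\<^sup>2"
    by (simp add: power2_eq_square mult_ac)
  show ?thesis
  proof (cases "v = 0")
    case True
    then show ?thesis
      using \<open>C \<ge> 0\<close> by (simp add: v_def[symmetric] sum_nonneg)
  next
    case False
    then show ?thesis
      using * by (intro mult_right_le_imp_le[OF *[unfolded v_def]]) (simp add: v_def)
  qed
qed

lemma frame_operator_has_sum:
  fixes g :: "'i \<Rightarrow> 'a::complex_hilbert_space"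
  assumes "C \<ge> 0"
    and bessel: "\<And>F h. finite F \<Longrightarrow> (\<Sum>i\<in>F. (cmod (cinner h (g i)))\<^sup>2) \<le> C * (norm h)\<^sup>2"
  obtains B where "bounded_clinear B" "\<And>h. ((\<lambda>i. cinner h (g i) *\<^sub>C g i) has_sum B h) UNIV"
proof -
  let ?v = "\<lambda>h i. cinner h (g i) *\<^sub>C g i"
  have "?v h summable_on UNIV" for h
  proof (rule summable_on_of_small_tails)
    fix e :: real
    assume "e > 0"
    define a where "a i = (cmod (cinner h (g i)))\<^sup>2" for i
    have "a summable_on UNIV"
      by (rule nonneg_bounded_partial_sums_imp_summable_on[where C = "C * (norm h)\<^sup>2"])
        (auto simp: a_def bessel eventually_finite_subsets_at_top)
    then obtain s where s: "(a has_sum s) UNIV"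
      by (auto simp: summable_on_def)
    \<comment> \<open>The summand 1 covers \<open>C = 0\<close> and makes the final estimate
      \<open>C * d < e\<^sup>2\<close> strict.\<close>
    define d where "d = e\<^sup>2 / (C + 1)"
    have d: "d > 0"
      using \<open>e > 0\<close> \<open>C \<ge> 0\<close> by (simp add: d_def)
    then have "\<forall>\<^sub>F A in finite_subsets_at_top UNIV. dist (sum a A) s < d"
      using s by (auto simp: has_sum_def tendsto_iff)
    then obtain X where X: "finite X" "dist (sum a X) s < d"
      by (auto simp: eventually_finite_subsets_at_top)
    have "norm (sum (?v h) G) < e" if G: "finite G" "G \<inter> X = {}" for G
    proof -
      \<comment> \<open>Since \<open>sum a X\<close> is within \<open>d\<close> of the total
        \<open>s\<close>, less than \<open>d\<close> remains for any \<open>G\<close> disjoint from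
        \<open>X\<close>.\<close>
      have "sum a G + sum a X = sum a (G \<union> X)"
        using G X by (simp add: sum.union_disjoint)
      also have "\<dots> \<le> s"
        using G X by (intro finite_sum_le_has_sum[OF s]) (auto simp: a_def)
      finally have "sum a G < d"
        using X by (simp add: dist_real_def)
      have "(norm (sum (?v h) G))\<^sup>2 \<le> C * sum a G"
        using norm_synthesis_le[OF \<open>C \<ge> 0\<close> bessel[OF G(1)]] by (simp add: a_def)
      also have "\<dots> \<le> C * d"
        using \<open>sum a G < d\<close> \<open>C \<ge> 0\<close> by (intro mult_left_mono) auto
      also have "\<dots> < (C + 1) * d"
        using d by (simp add: algebra_simps)
      also have "\<dots> = e\<^sup>2"
        using \<open>C \<ge> 0\<close> by (simp add: d_def)
      finally show ?thesis
        using \<open>e > 0\<close> by (simp add: power_less_imp_less_base)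
    qed
    then show "\<exists>F. finite F \<and> (\<forall>G. finite G \<and> G \<inter> F = {} \<longrightarrow> norm (sum (?v h) G) < e)"
      using X(1) by blast
  qed
  then obtain B where B: "\<And>h. (?v h has_sum B h) UNIV"
    unfolding summable_on_def by metis
  \<comment> \<open>Linearity of \<open>B\<close> comes from uniqueness of sums.\<close>
  have add: "B (x + y) = B x + B y" for x y
    using has_sum_add[OF B[of x] B[of y]] B[of "x + y"]
    by (simp add: cinner_add_left scaleC_add_left has_sum_unique)
  have scale: "B (c *\<^sub>C x) = c *\<^sub>C B x" for c x
    using has_sum_bounded_linear[OF bounded_linear_scaleC_right[of c] B[of x]] B[of "c *\<^sub>C x"]
    by (simp add: cinner_scaleC_left scaleC_scaleC has_sum_unique)
  have "norm (B h) \<le> norm h * C" for h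
  proof -
    \<comment> \<open>Analysis and synthesis each contribute a factor \<open>sqrt C\<close>.\<close>
    have "norm (sum (?v h) F) \<le> C * norm h" if "finite F" for F
    proof (rule power2_le_imp_le)
      have "(norm (sum (?v h) F))\<^sup>2 \<le> C * (\<Sum>i\<in>F. (cmod (cinner h (g i)))\<^sup>2)"
        by (rule norm_synthesis_le[OF \<open>C \<ge> 0\<close> bessel[OF that]])
      also have "\<dots> \<le> C * (C * (norm h)\<^sup>2)"
        using \<open>C \<ge> 0\<close> bessel[OF that] by (intro mult_left_mono) auto
      finally show "(norm (sum (?v h) F))\<^sup>2 \<le> (C * norm h)\<^sup>2"
        by (simp add: power2_eq_square mult_ac)
    qed (use \<open>C \<ge> 0\<close> in simp)
    then have "norm (B h) \<le> C * norm h"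
      using B[of h]
      by (intro tendsto_upperbound[OF tendsto_norm])
        (auto simp: has_sum_def eventually_finite_subsets_at_top)
    then show ?thesis
      by (simp add: mult.commute)
  qed
  then have "bounded_linear B"
    using add scale by (intro bounded_linear_intro) (auto simp flip: scaleC_of_real)
  then show ?thesis
    using that B scale by (auto simp: bounded_clinear_def)
qed

subsection \<open>Unconditional bases\<close>

text \<open>Supplies the Bessel hypothesis of \<open>frame_operator_has_sum\<close>; the bound
  \<open>d\<close> turns control of the terms of the expansion into control of the
  coefficients.\<close>

lemma unconditional_basis_bessel:
  fixes f g :: "'i \<Rightarrow> 'a::complex_hilbert_space"
  assumes expansion: "\<And>h. ((\<lambda>n. cinner h (g n) *\<^sub>C f n) has_sum h) UNIV"
    and "d > 0" and lower: "\<And>n. d \<le> norm (f n)"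
  obtains C where "C \<ge> 0"
    "\<And>F h. finite F \<Longrightarrow> (\<Sum>n\<in>F. (cmod (cinner h (g n)))\<^sup>2) \<le> C * (norm h)\<^sup>2"
proof -
  let ?v = "\<lambda>h n. cinner h (g n) *\<^sub>C f n"
  \<comment> \<open>The family in \<open>banach_steinhaus\<close> is indexed by a whole type, so
    infinite sets are assigned the zero operator.\<close>
  define T where "T F h = (if finite F then sum (?v h) F else 0)" for F h
  have "bounded_linear (T F)" for F
    unfolding T_def
    by (cases "finite F")
      (auto intro!: bounded_linear_sum bounded_linear_compose[OF bounded_linear_scaleC_left]
        bounded_linear_cinner_left)
  moreover have "\<exists>M. \<forall>F. norm (T F h) \<le> M" for h
  proof -
    obtain M where "\<And>F. finite F \<Longrightarrow> norm (sum (?v h) F) \<le> M"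
      using has_sum_finite_sums_bounded[OF expansion] by blast
    moreover from this[of "{}"] have "M \<ge> 0"
      by simp
    ultimately show ?thesis
      by (auto simp: T_def)
  qed
  ultimately obtain K where "K \<ge> 0" and "\<And>F h. norm (T F h) \<le> K * norm h"
    using banach_steinhaus[of T] by blast
  then have K: "norm (sum (?v h) F) \<le> K * norm h" if "finite F" for F h
    using that by (metis T_def)
  \<comment> \<open>The positive and the negative part of the signed sum each cost \<open>K\<close>,
    hence \<open>2 * K\<close>.\<close>
  have "(\<Sum>n\<in>F. (cmod (cinner h (g n)))\<^sup>2) \<le> (2 * K / d)\<^sup>2 * (norm h)\<^sup>2" if F: "finite F" for F h
  proof -
    have "d\<^sup>2 * (\<Sum>n\<in>F. (cmod (cinner h (g n)))\<^sup>2) \<le> (\<Sum>n\<in>F. (norm (?v h n))\<^sup>2)"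
      unfolding sum_distrib_left
    proof (rule sum_mono)
      fix n
      have "d\<^sup>2 \<le> (norm (f n))\<^sup>2"
        using lower[of n] \<open>d > 0\<close> by (intro power_mono) auto
      then show "d\<^sup>2 * (cmod (cinner h (g n)))\<^sup>2 \<le> (norm (?v h n))\<^sup>2"
        by (simp add: norm_scaleC power_mult_distrib mult.commute mult_right_mono)
    qed
    also obtain A where "A \<subseteq> F" and
      "(\<Sum>n\<in>F. (norm (?v h n))\<^sup>2) \<le> (norm (sum (?v h) A - sum (?v h) (F - A)))\<^sup>2"
      using exists_signs_sum_norm_square_le[OF F, of "?v h"] by blast
    note this(2)
    also have "norm (sum (?v h) A - sum (?v h) (F - A)) \<le> K * norm h + K * norm h"
      using F \<open>A \<subseteq> F\<close> finite_subset
      by (intro order_trans[OF norm_triangle_ineq4] add_mono K) auto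
    then have "(norm (sum (?v h) A - sum (?v h) (F - A)))\<^sup>2 \<le> (2 * K * norm h)\<^sup>2"
      by (intro power_mono) auto
    finally show ?thesis
      using \<open>d > 0\<close> by (simp add: power_divide power_mult_distrib field_simps)
  qed
  then show ?thesis
    using that[of "(2 * K / d)\<^sup>2"] by simp
qed

text \<open>Stating the result for any sequence \<open>A M\<close> that eventually contains each
  given finite set treats initial segments of the naturals and symmetric integer intervals
  together.\<close>

theorem unconditional_basis_frame_reconstruction_iff:
  fixes f :: "'i \<Rightarrow> 'a::complex_hilbert_space" and A :: "nat \<Rightarrow> 'i set"
  assumes basis: "unconditional_schauder_basis f"
    and exhaust: "filterlim A (finite_subsets_at_top UNIV) sequentially"
  shows "(\<exists>B. bounded_clinear B \<and> (\<forall>h. (\<lambda>M. \<Sum>n\<in>A M. cinner h (B (f n)) *\<^sub>C f n) \<longlonglongrightarrow> h)) \<longleftrightarrow>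
    (INF n. norm (f n)) > 0"
proof
  obtain g where biorth: "\<And>n k. cinner (f n) (g k) = (if n = k then 1 else 0)"
    and expansion: "\<And>h. ((\<lambda>n. cinner h (g n) *\<^sub>C f n) has_sum h) UNIV"
    using basis by (auto simp: unconditional_schauder_basis_def)
  {
    assume "\<exists>B. bounded_clinear B \<and> (\<forall>h. (\<lambda>M. \<Sum>n\<in>A M. cinner h (B (f n)) *\<^sub>C f n) \<longlonglongrightarrow> h)"
    then obtain B where B: "bounded_clinear B"
      and rec: "\<And>h. (\<lambda>M. \<Sum>n\<in>A M. cinner h (B (f n)) *\<^sub>C f n) \<longlonglongrightarrow> h"
      by blast
    \<comment> \<open>Pair the partial sums with \<open>g k\<close>: once \<open>A M\<close>
      contains \<open>k\<close>, biorthogonality leaves only the k-th coefficient, so the limit is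
      eventually attained.\<close>
    have coeff: "cinner h (B (f k)) = cinner h (g k)" for h k
    proof (rule LIMSEQ_unique)
      show "(\<lambda>M. cinner (\<Sum>n\<in>A M. cinner h (B (f n)) *\<^sub>C f n) (g k)) \<longlonglongrightarrow> cinner h (g k)"
        by (rule bounded_linear.tendsto[OF bounded_linear_cinner_left rec])
      have "\<forall>\<^sub>F M in sequentially. finite (A M) \<and> {k} \<subseteq> A M \<and> A M \<subseteq> UNIV"
        using exhaust unfolding filterlim_finite_subsets_at_top by blast
      then have "\<forall>\<^sub>F M in sequentially.
          cinner h (B (f k)) = cinner (\<Sum>n\<in>A M. cinner h (B (f n)) *\<^sub>C f n) (g k)"
        by eventually_elim (simp add: cinner_sum_left cinner_scaleC_left biorth if_distrib cong: if_cong)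
      then show "(\<lambda>M. cinner (\<Sum>n\<in>A M. cinner h (B (f n)) *\<^sub>C f n) (g k)) \<longlonglongrightarrow> cinner h (B (f k))"
        by (rule tendsto_eventually[OF eventually_mono]) simp
    qed
    obtain L where L: "L > 0" "\<And>x. norm (B x) \<le> norm x * L"
      using B bounded_linear.pos_bounded unfolding bounded_clinear_def by blast
    have "sqrt (1 / L) \<le> norm (f k)" for k
    proof (rule real_le_lsqrt)
      have "1 = cmod (cinner (f k) (B (f k)))"
        by (simp add: coeff biorth)
      also have "\<dots> \<le> norm (f k) * (norm (f k) * L)"
        by (rule order_trans[OF cmod_cinner_le]) (simp add: L mult_left_mono)
      finally show "1 / L \<le> (norm (f k))\<^sup>2"
        using L by (simp add: field_simps power2_eq_square)
    qed simp
    then have "sqrt (1 / L) \<le> (INF n. norm (f n))"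
      by (intro cINF_greatest) auto
    then show "(INF n. norm (f n)) > 0"
      using L by (smt (verit) divide_pos_pos real_sqrt_gt_0_iff)
  }
  assume "(INF n. norm (f n)) > 0"
  moreover have "(INF n. norm (f n)) \<le> norm (f k)" for k
    by (intro cINF_lower bdd_belowI[of _ 0]) auto
  ultimately obtain C where "C \<ge> 0"
    "\<And>F h. finite F \<Longrightarrow> (\<Sum>n\<in>F. (cmod (cinner h (g n)))\<^sup>2) \<le> C * (norm h)\<^sup>2"
    using unconditional_basis_bessel[OF expansion, of "INF n. norm (f n)"] by blast
  then obtain B where B: "bounded_clinear B"
    and sum: "\<And>h. ((\<lambda>n. cinner h (g n) *\<^sub>C g n) has_sum B h) UNIV"
    using frame_operator_has_sum[of C g] by blast
  \<comment> \<open>By biorthogonality, the series defining \<open>B (f k)\<close> has a single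
    nonzero term.\<close>
  have Bf: "B (f k) = g k" for k
  proof (rule has_sum_unique[OF sum])
    show "((\<lambda>n. cinner (f k) (g n) *\<^sub>C g n) has_sum g k) UNIV"
      by (rule has_sum_finite_neutralI[of "{k}"]) (auto simp: biorth scaleC_zero_left scaleC_one)
  qed
  \<comment> \<open>Convergence of the net of finite sums passes to the sums along
    \<open>A\<close>.\<close>
  have "(\<lambda>M. \<Sum>n\<in>A M. cinner h (B (f n)) *\<^sub>C f n) \<longlonglongrightarrow> h" for h
    using filterlim_compose[OF _ exhaust] expansion[of h] unfolding Bf has_sum_def by blast
  then show "\<exists>B. bounded_clinear B \<and> (\<forall>h. (\<lambda>M. \<Sum>n\<in>A M. cinner h (B (f n)) *\<^sub>C f n) \<longlonglongrightarrow> h)"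
    using B by blast
qed

theorem theorem7p1:
  shows "(\<forall>f :: nat \<Rightarrow> 'a::complex_hilbert_space. unconditional_schauder_basis f \<longrightarrow>
            (frame_reconstruction_nat f \<longleftrightarrow> (INF n. norm (f n)) > 0)) \<and>
         (\<forall>f :: int \<Rightarrow> 'a. unconditional_schauder_basis f \<longrightarrow>
            (frame_reconstruction_int f \<longleftrightarrow> (INF n. norm (f n)) > 0))"
proof (intro conjI allI impI)
  fix f :: "nat \<Rightarrow> 'a"
  assume "unconditional_schauder_basis f"
  \<comment> \<open>\<open>sums\<close> takes partial sums over \<open>{..<n}\<close>, which exhaust
    the naturals.\<close>
  from unconditional_basis_frame_reconstruction_iff[OF this filterlim_lessThan_at_top]
  show "frame_reconstruction_nat f \<longleftrightarrow> (INF n. norm (f n)) > 0"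
    by (simp add: frame_reconstruction_nat_def sums_def)
next
  fix f :: "int \<Rightarrow> 'a"
  assume basis: "unconditional_schauder_basis f"
  have "filterlim (\<lambda>M. {- int M..int M}) (finite_subsets_at_top UNIV) sequentially"
    unfolding filterlim_finite_subsets_at_top
  proof (intro allI impI)
    fix X :: "int set"
    assume "finite X \<and> X \<subseteq> UNIV"
    \<comment> \<open>The sum of absolute values is a convenient radius for a symmetric interval
      containing \<open>X\<close>; it needs no case for empty \<open>X\<close>.\<close>
    then have "\<bar>x\<bar> \<le> (\<Sum>y\<in>X. \<bar>y\<bar>)" if "x \<in> X" for x
      using that by (intro member_le_sum) auto
    then have "X \<subseteq> {- int M..int M}" if "M \<ge> nat (\<Sum>y\<in>X. \<bar>y\<bar>)" for M
      using that by (fastforce simp: abs_le_iff)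
    then show "\<forall>\<^sub>F M in sequentially. finite {- int M..int M} \<and> X \<subseteq> {- int M..int M} \<and>
        {- int M..int M} \<subseteq> UNIV"
      by (auto simp: eventually_sequentially)
  qed
  from unconditional_basis_frame_reconstruction_iff[OF basis this]
  show "frame_reconstruction_int f \<longleftrightarrow> (INF n. norm (f n)) > 0"
    by (simp add: frame_reconstruction_int_def)
qed

end
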